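(* Let $(G,\mathcal B)$ be a Rota-Baxter group of weight $-1$, let $\widetilde{\mathcal B}(a)=a\mathcal B(a^{-1})$ for $a\in G$, and let $G_+=\mathrm{Im}\,\mathcal B$ and $G_-=\mathrm{Im}\,\widetilde{\mathcal B}$. Define $\rho:G_+\times G_-\to G_-$ and $\mu:G_-\times G_+\to G_+$ by $$\rho(\mathcal B(a))(\widetilde{\mathcal B}(b))=\widetilde{\mathcal B}(\mathrm{Ad}_{\mathcal B(a)}(b)),\qquad \mu(\widetilde{\mathcal B}(a))(\mathcal B(b))=\mathcal B(\mathrm{Ad}_{\widetilde{\mathcal B}(a)}(b)),\qquad\forall a,b\in G.$$ Then $(G_+,G_-,\rho,\mu)$ is a matched pair of groups (in particular $\rho$ and $\mu$ are well defined).
   Context: For a group $G$ and $a,b\in G$, $\mathrm{Ad}_a(b)=aba^{-1}$. A Rota-Baxter operator of weight $-1$ on a group $G$ is a map $\mathcal B:G\to G$ with $\mathcal B(a)\mathcal B(b)=\mathcal B\big((\mathrm{Ad}_{\mathcal B(a)}(b))\,a\big)$ for all $a,b\in G$; then $(G,\mathcal B)$ is a Rota-Baxter group of weight $-1$. In this case $\mathrm{Im}\,\mathcal B$ and $\mathrm{Im}\,\widetilde{\mathcal B}$ are subgroups of $G$. A matched pair of groups is a quadruple $(G,H,\rho,\mu)$ where $G,H$ are groups with identities $e,e'$, $\rho:G\times H\to H$ is a (left) action of $G$ on the set $H$, $\mu:H\times G\to G$ is a (left) action of $H$ on the set $G$ (written $\rho(a)b$, $\mu(b)a$), and (a) $\rho(a^{-1})(b_1b_2)=(\rho(a^{-1})b_1)\,\big(\rho((\mu(b_1^{-1})a)^{-1})b_2\big)$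 for all $a\in G$, $b_1,b_2\in H$; (b) $\mu(b^{-1})(a_1a_2)=(\mu(b^{-1})a_1)\,\big(\mu((\rho(a_1^{-1})b)^{-1})a_2\big)$ for all $a_1,a_2\in G$, $b\in H$; (c) $\rho(a)e'=e'$ for all $a\in G$; (d) $\mu(b)e=e$ for all $b\in H$. *)

theory Defs
  imports "HOL-Algebra.Group_Action"
begin

definition Ad :: "('a, 'm) monoid_scheme \<Rightarrow> 'a \<Rightarrow> 'a \<Rightarrow> 'a"
  where "Ad G a b = a \<otimes>\<^bsub>G\<^esub> b \<otimes>\<^bsub>G\<^esub> inv\<^bsub>G\<^esub> a"

locale rota_baxter_group_neg_one = group G
  for G :: "('a, 'm) monoid_scheme" (structure) and B :: "'a \<Rightarrow> 'a" +
  assumes B_closed: "a \<in> carrier G \<Longrightarrow> B a \<in> carrier G"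
    and rota_baxter:
      "\<lbrakk>a \<in> carrier G; b \<in> carrier G\<rbrakk>
        \<Longrightarrow> B a \<otimes> B b = B (Ad G (B a) b \<otimes> a)"

definition rb_tilde :: "('a, 'm) monoid_scheme \<Rightarrow> ('a \<Rightarrow> 'a) \<Rightarrow> 'a \<Rightarrow> 'a"
  where "rb_tilde G B a = a \<otimes>\<^bsub>G\<^esub> B (inv\<^bsub>G\<^esub> a)"

definition rb_plus :: "('a, 'm) monoid_scheme \<Rightarrow> ('a \<Rightarrow> 'a) \<Rightarrow> ('a, 'm) monoid_scheme"
  where "rb_plus G B = G\<lparr>carrier := B ` carrier G\<rparr>"

definition rb_minus :: "('a, 'm) monoid_scheme \<Rightarrow> ('a \<Rightarrow> 'a) \<Rightarrow> ('a, 'm) monoid_scheme"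
  where "rb_minus G B = G\<lparr>carrier := rb_tilde G B ` carrier G\<rparr>"

text \<open>
  A \<^locale>\<open>group_action\<close> is a homomorphism into the group of bijections that are
  \<^const>\<open>undefined\<close> outside the set acted upon, so the actions are given as
  such extensional functions.
\<close>

locale matched_pair_groups =
  G: group G + H: group H +
  \<rho>: group_action G "carrier H" \<rho> + \<mu>: group_action H "carrier G" \<mu>
  for G :: "('a, 'm) monoid_scheme" and H :: "('b, 'n) monoid_scheme"
    and \<rho> :: "'a \<Rightarrow> 'b \<Rightarrow> 'b" and \<mu> :: "'b \<Rightarrow> 'a \<Rightarrow> 'a" +
  assumes \<rho>_mult:
      "\<lbrakk>a \<in> carrier G; b1 \<in> carrier H; b2 \<in> carrier H\<rbrakk> \<Longrightarrow>
        \<rho> (inv\<^bsub>G\<^esub> a) (b1 \<otimes>\<^bsub>H\<^esub> b2) =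
        \<rho> (inv\<^bsub>G\<^esub> a) b1 \<otimes>\<^bsub>H\<^esub> \<rho> (inv\<^bsub>G\<^esub> (\<mu> (inv\<^bsub>H\<^esub> b1) a)) b2"
    and \<mu>_mult:
      "\<lbrakk>a1 \<in> carrier G; a2 \<in> carrier G; b \<in> carrier H\<rbrakk> \<Longrightarrow>
        \<mu> (inv\<^bsub>H\<^esub> b) (a1 \<otimes>\<^bsub>G\<^esub> a2) =
        \<mu> (inv\<^bsub>H\<^esub> b) a1 \<otimes>\<^bsub>G\<^esub> \<mu> (inv\<^bsub>H\<^esub> (\<rho> (inv\<^bsub>G\<^esub> a1) b)) a2"
    and \<rho>_one: "a \<in> carrier G \<Longrightarrow> \<rho> a \<one>\<^bsub>H\<^esub> = \<one>\<^bsub>H\<^esub>"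
    and \<mu>_one: "b \<in> carrier H \<Longrightarrow> \<mu> b \<one>\<^bsub>G\<^esub> = \<one>\<^bsub>G\<^esub>"

text \<open>
  The defining equations of the two maps are predicates here, because they prescribe values on
  representatives. That the maps are well defined means that exactly one map satisfies each of them.
\<close>

definition is_rb_rho ::
  "('a, 'm) monoid_scheme \<Rightarrow> ('a \<Rightarrow> 'a) \<Rightarrow> ('a \<Rightarrow> 'a \<Rightarrow> 'a) \<Rightarrow> bool"
  where "is_rb_rho G B \<rho> \<longleftrightarrow>
    \<rho> \<in> carrier (rb_plus G B) \<rightarrow>\<^sub>E (carrier (rb_minus G B) \<rightarrow>\<^sub>E carrier (rb_minus G B)) \<and>
    (\<forall>a\<in>carrier G. \<forall>b\<in>carrier G.
      \<rho> (B a) (rb_tilde G B b) = rb_tilde G B (Ad G (B a) b))"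

definition is_rb_mu ::
  "('a, 'm) monoid_scheme \<Rightarrow> ('a \<Rightarrow> 'a) \<Rightarrow> ('a \<Rightarrow> 'a \<Rightarrow> 'a) \<Rightarrow> bool"
  where "is_rb_mu G B \<mu> \<longleftrightarrow>
    \<mu> \<in> carrier (rb_minus G B) \<rightarrow>\<^sub>E (carrier (rb_plus G B) \<rightarrow>\<^sub>E carrier (rb_plus G B)) \<and>
    (\<forall>a\<in>carrier G. \<forall>b\<in>carrier G.
      \<mu> (rb_tilde G B a) (B b) = B (Ad G (rb_tilde G B a) b))"

end

theory Submission
  imports Defs
begin

text \<open>
  Write \<open>T\<close> for \<open>rb_tilde G B\<close>. Two observations carry the proof.

  First, the situation is symmetric. The map \<open>T\<close> is again a Rota-Baxter operator of weight
  \<open>-1\<close>, and applying the tilde construction to \<open>T\<close> gives back \<open>B\<close>. This exchanges the two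
  image groups, the two maps \<open>\<rho>\<close> and \<open>\<mu>\<close>, and the two compatibility conditions of a matched
  pair, so only the statements about \<open>\<rho>\<close> need an argument.

  Secondly, the value prescribed for \<open>\<rho> (B a) (T b)\<close> satisfies, with \<open>z = B a \<otimes> T b\<close>,
  \<open>T (Ad (B a) b) = z \<otimes> B (Ad (inv z) (inv a))\<close> (lemma \<open>tilde_Ad_factor\<close>).
  The right-hand side contains \<open>b\<close> only through \<open>T b\<close>, which is exactly well-definedness of
  \<open>\<rho>\<close>. That \<open>\<rho>\<close> is an action is then the fact that \<open>Ad\<close> is one. The last factor
  on the right is the value of \<open>\<mu>\<close> at \<open>inv (T b)\<close> and \<open>inv (B a)\<close>, so the formula also reads
  \<open>B a \<otimes> T b = \<rho> (B a) (T b) \<otimes> inv (\<mu> (inv (T b)) (inv (B a)))\<close>.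
  Both sides of the compatibility condition are values of \<open>T\<close> at products of conjugates, by the
  Rota-Baxter identity for \<open>T\<close>, and this factorisation says that the conjugating elements agree.
  The images of \<open>B\<close> and \<open>T\<close> may intersect nontrivially, so well-definedness cannot be
  obtained from uniqueness of such factorisations; the explicit formula is what replaces it.
\<close>

section \<open>Conjugation\<close>

context group
begin

lemma inv_mult_cancel [simp]:
  assumes "x \<in> carrier G" "y \<in> carrier G"
  shows "inv x \<otimes> (x \<otimes> y) = y" "x \<otimes> (inv x \<otimes> y) = y"
  using assms by (simp_all flip: m_assoc)

lemma Ad_closed [simp]:
  "\<lbrakk>x \<in> carrier G; b \<in> carrier G\<rbrakk> \<Longrightarrow> Ad G x b \<in> carrier G"
  by (simp add: Ad_def)

lemma Ad_mult:
  "\<lbrakk>x \<in> carrier G; y \<in> carrier G; b \<in> carrier G\<rbrakk> \<Longrightarrow> Ad G (x \<otimes> y) b = Ad G x (Ad G y b)"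
  by (simp add: Ad_def m_assoc inv_mult_group)

lemma Ad_one [simp]: "b \<in> carrier G \<Longrightarrow> Ad G \<one> b = b"
  by (simp add: Ad_def)

lemma Ad_arg_one [simp]: "x \<in> carrier G \<Longrightarrow> Ad G x \<one> = \<one>"
  by (simp add: Ad_def)

lemma Ad_arg_mult:
  "\<lbrakk>x \<in> carrier G; b \<in> carrier G; c \<in> carrier G\<rbrakk> \<Longrightarrow> Ad G x (b \<otimes> c) = Ad G x b \<otimes> Ad G x c"
  by (simp add: Ad_def m_assoc)

lemma inv_Ad:
  "\<lbrakk>x \<in> carrier G; b \<in> carrier G\<rbrakk> \<Longrightarrow> inv (Ad G x b) = Ad G x (inv b)"
  by (simp add: Ad_def m_assoc inv_mult_group)

end

section \<open>Rota-Baxter groups and the duality between an operator and its tilde\<close>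

context rota_baxter_group_neg_one
begin

abbreviation T :: "'a \<Rightarrow> 'a" where "T \<equiv> rb_tilde G B"

declare B_closed [simp]

lemma T_closed [simp]: "a \<in> carrier G \<Longrightarrow> T a \<in> carrier G"
  by (simp add: rb_tilde_def)

lemma B_one [simp]: "B \<one> = \<one>"
proof -
  have "B \<one> \<otimes> B \<one> = B \<one>"
    using rota_baxter[of \<one> \<one>] by simp
  then show ?thesis
    by simp
qed

lemma T_one [simp]: "T \<one> = \<one>"
  by (simp add: rb_tilde_def)

text \<open>
  The operation \<open>(a, b) \<mapsto> Ad G (B a) b \<otimes> a\<close>, which \<open>B\<close> turns into multiplication, is a
  group operation with identity \<open>\<one>\<close>; the argument of \<open>B\<close> on the right is the inverse of \<open>a\<close>
  for it.
\<close>

lemma inv_B: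
  assumes a: "a \<in> carrier G"
  shows "inv (B a) = B (Ad G (inv (B a)) (inv a))"
proof -
  have "B a \<otimes> B (Ad G (inv (B a)) (inv a)) = B (Ad G (B a) (Ad G (inv (B a)) (inv a)) \<otimes> a)"
    using a by (simp add: rota_baxter)
  also have "\<dots> = \<one>"
    using a by (simp flip: Ad_mult)
  finally have "B (Ad G (inv (B a)) (inv a)) \<otimes> B a = \<one>"
    using a by (intro inv_comm[of "B a"]) simp_all
  then show ?thesis
    using a by (intro inv_equality) simp_all
qed

lemma subgroup_range_B: "subgroup (B ` carrier G) G"
proof (rule subgroupI)
  show "B ` carrier G \<noteq> {}"
    using one_closed by blast
next
  fix g assume "g \<in> B ` carrier G"
  then obtain a where a: "a \<in> carrier G" "g = B a" by blast
  have "inv g = B (Ad G (inv (B a)) (inv a))"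
    unfolding a(2) by (rule inv_B[OF a(1)])
  then show "inv g \<in> B ` carrier G"
    using a by simp
next
  fix g h assume "g \<in> B ` carrier G" "h \<in> B ` carrier G"
  then show "g \<otimes> h \<in> B ` carrier G"
    by (elim imageE) (simp add: rota_baxter)
qed (auto simp: image_subset_iff)

lemma rota_baxter_tilde: "rota_baxter_group_neg_one G T"
proof unfold_locales
  fix a b assume ab: "a \<in> carrier G" "b \<in> carrier G"
  let ?c = "a \<otimes> Ad G (B (inv a)) b"
  have c: "Ad G (T a) b \<otimes> a = ?c"
    using ab by (simp add: Ad_def rb_tilde_def m_assoc inv_mult_group)
  \<comment> \<open>The inverse of \<open>?c\<close> is the argument at which the identity for \<open>B\<close> evaluates.\<close>
  have "inv ?c = Ad G (B (inv a)) (inv b) \<otimes> inv a"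
    using ab by (simp add: inv_mult_group inv_Ad)
  then have "B (inv ?c) = B (inv a) \<otimes> B (inv b)"
    using ab by (simp add: rota_baxter)
  then show "T a \<otimes> T b = T (Ad G (T a) b \<otimes> a)"
    unfolding c using ab by (simp add: rb_tilde_def Ad_def m_assoc)
qed simp

lemma tilde_tilde: "a \<in> carrier G \<Longrightarrow> rb_tilde G T a = B a"
  by (simp add: rb_tilde_def)

lemma rb_plus_tilde: "rb_plus G T = rb_minus G B"
  by (simp add: rb_plus_def rb_minus_def)

lemma rb_minus_tilde: "rb_minus G T = rb_plus G B"
  by (simp add: rb_plus_def rb_minus_def tilde_tilde cong: image_cong)

lemma is_rb_rho_tilde: "is_rb_rho G T \<mu> \<longleftrightarrow> is_rb_mu G B \<mu>"
  by (simp add: is_rb_rho_def is_rb_mu_def rb_plus_tilde rb_minus_tilde tilde_tilde)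

lemma is_rb_mu_tilde: "is_rb_mu G T \<rho> \<longleftrightarrow> is_rb_rho G B \<rho>"
  by (simp add: is_rb_rho_def is_rb_mu_def rb_plus_tilde rb_minus_tilde tilde_tilde)

lemma group_rb_plus: "group (rb_plus G B)"
  unfolding rb_plus_def by (rule subgroup_imp_group[OF subgroup_range_B])

lemma group_rb_minus: "group (rb_minus G B)"
  using rota_baxter_group_neg_one.group_rb_plus[OF rota_baxter_tilde]
  by (simp add: rb_plus_tilde)

lemma rb_plus_simps:
  "carrier (rb_plus G B) = B ` carrier G"
  "x \<otimes>\<^bsub>rb_plus G B\<^esub> y = x \<otimes> y"
  "\<one>\<^bsub>rb_plus G B\<^esub> = \<one>"
  "x \<in> B ` carrier G \<Longrightarrow> inv\<^bsub>rb_plus G B\<^esub> x = inv x"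
  by (simp_all add: rb_plus_def m_inv_consistent[OF subgroup_range_B])

lemma rb_minus_simps:
  "carrier (rb_minus G B) = T ` carrier G"
  "x \<otimes>\<^bsub>rb_minus G B\<^esub> y = x \<otimes> y"
  "\<one>\<^bsub>rb_minus G B\<^esub> = \<one>"
  "x \<in> T ` carrier G \<Longrightarrow> inv\<^bsub>rb_minus G B\<^esub> x = inv x"
  using rota_baxter_group_neg_one.rb_plus_simps[OF rota_baxter_tilde]
  by (simp_all add: rb_plus_tilde)

section \<open>The factorisation formula and the action\<close>

text \<open>
  With \<open>x = Ad G (B a) (inv b)\<close>, the identity for \<open>B\<close> evaluates \<open>B (x \<otimes> a)\<close> as
  \<open>B a \<otimes> B (inv b)\<close>. Multiplying by a further value of \<open>B\<close>, chosen so that the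
  factor \<open>a\<close> is removed from the argument, evaluates \<open>B x\<close>, and
  \<open>T (Ad G (B a) b) = inv x \<otimes> B x\<close>.
\<close>

lemma tilde_Ad_factor:
  assumes a: "a \<in> carrier G" and b: "b \<in> carrier G"
  shows "T (Ad G (B a) b) = B a \<otimes> T b \<otimes> B (Ad G (inv (B a \<otimes> T b)) (inv a))"
proof -
  define x where "x = Ad G (B a) (inv b)"
  define h where "h = B a \<otimes> B (inv b)"
  have x: "x \<in> carrier G" and h: "h \<in> carrier G"
    using a b by (simp_all add: x_def h_def)
  have h_eq: "h = B (x \<otimes> a)"
    unfolding x_def h_def using a b by (simp add: rota_baxter)
  have z: "inv x \<otimes> h = B a \<otimes> T b"
    using a b by (simp add: x_def h_def inv_Ad Ad_def rb_tilde_def m_assoc inv_mult_group)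
  let ?c = "Ad G (inv h \<otimes> x) (inv a)"
  have "Ad G h ?c \<otimes> (x \<otimes> a) = x"
    using a x h by (simp add: Ad_def m_assoc inv_mult_group)
  then have "B x = h \<otimes> B ?c"
    using rota_baxter[of "x \<otimes> a" ?c] a x h by (simp flip: h_eq)
  moreover have "T (Ad G (B a) b) = inv x \<otimes> B x"
    using a b by (simp add: rb_tilde_def x_def inv_Ad)
  ultimately show ?thesis
    using a x h by (simp add: m_assoc inv_mult_group flip: z)
qed

lemma tilde_Ad_cong:
  assumes "g \<in> B ` carrier G" "b \<in> carrier G" "b' \<in> carrier G" "T b = T b'"
  shows "T (Ad G g b) = T (Ad G g b')"
  using assms by (auto simp: tilde_Ad_factor)

lemma rb_rho_apply:
  assumes "is_rb_rho G B \<rho>" "g \<in> B ` carrier G" "b \<in> carrier G"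
  shows "\<rho> g (T b) = T (Ad G g b)"
  using assms by (auto simp: is_rb_rho_def)

lemma rb_rho_fun:
  assumes "is_rb_rho G B \<rho>"
  shows "\<rho> \<in> B ` carrier G \<rightarrow>\<^sub>E (T ` carrier G \<rightarrow>\<^sub>E T ` carrier G)"
  using assms by (simp add: is_rb_rho_def rb_plus_simps rb_minus_simps)

lemma rb_rho_unique:
  assumes \<rho>: "is_rb_rho G B \<rho>" and \<sigma>: "is_rb_rho G B \<sigma>"
  shows "\<rho> = \<sigma>"
proof (rule PiE_ext[OF rb_rho_fun[OF \<rho>] rb_rho_fun[OF \<sigma>]])
  fix g assume g: "g \<in> B ` carrier G"
  show "\<rho> g = \<sigma> g"
  proof (rule PiE_ext[OF PiE_mem[OF rb_rho_fun[OF \<rho>] g] PiE_mem[OF rb_rho_fun[OF \<sigma>] g]])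
    fix h assume "h \<in> T ` carrier G"
    then show "\<rho> g h = \<sigma> g h"
      using rb_rho_apply[OF \<rho> g] rb_rho_apply[OF \<sigma> g] by auto
  qed
qed

lemma ex1_rb_rho: "\<exists>!\<rho>. is_rb_rho G B \<rho>"
proof (rule ex_ex1I)
  define r where
    "r = (\<lambda>g\<in>B ` carrier G. \<lambda>h\<in>T ` carrier G. T (Ad G g (inv_into (carrier G) T h)))"
  have pre: "inv_into (carrier G) T h \<in> carrier G" if "h \<in> T ` carrier G" for h
    using that by (rule inv_into_into)
  have "r (B a) (T b) = T (Ad G (B a) b)" if ab: "a \<in> carrier G" "b \<in> carrier G" for a b
  proof -
    have "T (inv_into (carrier G) T (T b)) = T b"
      using ab by (intro f_inv_into_f imageI)
    then have "T (Ad G (B a) (inv_into (carrier G) T (T b))) = T (Ad G (B a) b)"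
      using ab by (intro tilde_Ad_cong pre imageI)
    then show ?thesis
      using ab by (simp add: r_def)
  qed
  moreover have "r \<in> B ` carrier G \<rightarrow>\<^sub>E (T ` carrier G \<rightarrow>\<^sub>E T ` carrier G)"
    unfolding r_def
  proof (intro restrict_PiE_iff[THEN iffD2] ballI)
    fix g h assume "g \<in> B ` carrier G" "h \<in> T ` carrier G"
    then show "T (Ad G g (inv_into (carrier G) T h)) \<in> T ` carrier G"
      using pre by (intro imageI Ad_closed) auto
  qed
  ultimately show "\<exists>\<rho>. is_rb_rho G B \<rho>"
    unfolding is_rb_rho_def rb_plus_simps rb_minus_simps by blast
qed (rule rb_rho_unique)

lemma ex1_rb_mu: "\<exists>!\<mu>. is_rb_mu G B \<mu>"
  using rota_baxter_group_neg_one.ex1_rb_rho[OF rota_baxter_tilde]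
  by (simp add: is_rb_rho_tilde)

lemma rb_mu_apply:
  assumes "is_rb_mu G B \<mu>" "h \<in> T ` carrier G" "b \<in> carrier G"
  shows "\<mu> h (B b) = B (Ad G h b)"
  using assms by (auto simp: is_rb_mu_def)

lemma group_action_rb_rho:
  assumes \<rho>: "is_rb_rho G B \<rho>"
  shows "group_action (rb_plus G B) (carrier (rb_minus G B)) \<rho>"
proof -
  let ?P = "B ` carrier G" and ?M = "T ` carrier G"
  interpret P: subgroup ?P G by (rule subgroup_range_B)
  note rho_apply = rb_rho_apply[OF \<rho>]
  have ext: "\<rho> g \<in> ?M \<rightarrow>\<^sub>E ?M" if "g \<in> ?P" for g
    using that by (rule PiE_mem[OF rb_rho_fun[OF \<rho>]])
  have mult: "\<rho> (g \<otimes> g') h = \<rho> g (\<rho> g' h)" if "g \<in> ?P" "g' \<in> ?P" "h \<in> ?M" for g g' h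
    using that P.subset by (auto simp: rho_apply Ad_mult)
  have one: "\<rho> \<one> h = h" if "h \<in> ?M" for h
    using that by (auto simp: rho_apply)
  have bij: "\<rho> g \<in> Bij ?M" if g: "g \<in> ?P" for g
  proof -
    have "bij_betw (\<rho> g) ?M ?M"
    proof (rule bij_betwI[where g = "\<rho> (inv g)"])
      show "\<rho> g \<in> ?M \<rightarrow> ?M" "\<rho> (inv g) \<in> ?M \<rightarrow> ?M"
        using ext[OF g] ext[OF P.m_inv_closed[OF g]] by (auto simp: PiE_iff)
      show "\<rho> (inv g) (\<rho> g h) = h" "\<rho> g (\<rho> (inv g) h) = h" if "h \<in> ?M" for h
        using that g P.mem_carrier[OF g] P.m_inv_closed[OF g]
        by (simp_all add: one flip: mult)
    qed
    then show ?thesis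
      using ext[OF g] by (simp add: Bij_def PiE_iff)
  qed
  have "\<rho> \<in> hom (rb_plus G B) (BijGroup ?M)"
  proof (rule homI)
    fix g g' assume "g \<in> carrier (rb_plus G B)" "g' \<in> carrier (rb_plus G B)"
    then have g: "g \<in> ?P" "g' \<in> ?P" by (simp_all add: rb_plus_simps)
    have "\<rho> (g \<otimes> g') = compose ?M (\<rho> g) (\<rho> g')"
      using ext[OF P.m_closed[OF g]] mult[OF g]
      by (intro extensionalityI[of _ ?M]) (simp_all add: PiE_iff compose_eq)
    then show "\<rho> (g \<otimes>\<^bsub>rb_plus G B\<^esub> g') = \<rho> g \<otimes>\<^bsub>BijGroup ?M\<^esub> \<rho> g'"
      using g by (simp add: BijGroup_def bij rb_plus_simps)
  qed (simp add: BijGroup_def bij rb_plus_simps)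
  then show ?thesis
    unfolding group_action_def group_hom_def group_hom_axioms_def
    by (simp add: group_rb_plus group_BijGroup rb_minus_simps)
qed

section \<open>Compatibility of the two actions\<close>

text \<open>
  Writing \<open>b1 = T u\<close> and \<open>b2 = T v\<close>, both sides are values of \<open>T\<close> at a conjugate of \<open>v\<close> times
  \<open>Ad (inv g) u\<close>. The conjugating elements agree by the factorisation formula, in which
  the last factor is recognised as \<open>\<mu> (inv b1) g\<close> by means of the formula for \<open>inv (B a)\<close>.
\<close>

lemma rb_rho_mult:
  assumes \<rho>: "is_rb_rho G B \<rho>" and \<mu>: "is_rb_mu G B \<mu>"
    and g: "g \<in> B ` carrier G" and b1: "b1 \<in> T ` carrier G" and b2: "b2 \<in> T ` carrier G"
  shows "\<rho> (inv g) (b1 \<otimes> b2) = \<rho> (inv g) b1 \<otimes> \<rho> (inv (\<mu> (inv b1) g)) b2"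
proof -
  interpret dual: rota_baxter_group_neg_one G T by (rule rota_baxter_tilde)
  note P_inv_closed = subgroup.m_inv_closed[OF subgroup_range_B]
    and P_mem_carrier = subgroup.mem_carrier[OF subgroup_range_B]
    and M_inv_closed = subgroup.m_inv_closed[OF dual.subgroup_range_B]
  obtain a where inv_g: "inv g = B a" and a: "a \<in> carrier G"
    using P_inv_closed[OF g] by (rule imageE)
  obtain u where u: "b1 = T u" "u \<in> carrier G"
    using b1 by (rule imageE)
  obtain v where v: "b2 = T v" "v \<in> carrier G"
    using b2 by (rule imageE)
  define m where "m = \<mu> (inv b1) g"
  define w where "w = Ad G (B a) u"
  have w: "w \<in> carrier G"
    using a u by (simp add: w_def)
  have "g = inv (B a)"
    using P_mem_carrier[OF g] by (simp flip: inv_g)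
  then have "g = B (Ad G (inv (B a)) (inv a))"
    by (rule trans) (rule inv_B[OF a])
  then have m_eq: "m = B (Ad G (inv b1) (Ad G (inv (B a)) (inv a)))"
    using rb_mu_apply[OF \<mu> M_inv_closed[OF b1]] a by (simp add: m_def)
  then have m: "m \<in> B ` carrier G" "m \<in> carrier G"
    using a u by auto
  have "T w = B a \<otimes> T u \<otimes> m"
    using a u by (simp add: w_def tilde_Ad_factor m_eq inv_mult_group Ad_mult)
  then have factor: "T w \<otimes> inv m = B a \<otimes> T u"
    using a u m by (simp add: m_assoc)
  have "\<rho> (inv g) (b1 \<otimes> b2) = T (Ad G (B a) (Ad G (T u) v \<otimes> u))"
    using rb_rho_apply[OF \<rho>] a u v by (simp add: inv_g dual.rota_baxter)
  also have "\<dots> = T (Ad G (T w \<otimes> inv m) v \<otimes> w)"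
    unfolding factor using a u v by (simp add: w_def Ad_arg_mult Ad_mult)
  also have "\<dots> = T w \<otimes> T (Ad G (inv m) v)"
    using w m v by (simp add: dual.rota_baxter Ad_mult)
  also have "\<dots> = \<rho> (inv g) b1 \<otimes> \<rho> (inv m) b2"
    using rb_rho_apply[OF \<rho>] P_inv_closed[OF m(1)] a u v by (simp add: inv_g w_def)
  finally show ?thesis
    by (simp add: m_def)
qed

lemma rb_rho_one:
  assumes "is_rb_rho G B \<rho>" "g \<in> B ` carrier G"
  shows "\<rho> g \<one> = \<one>"
  using rb_rho_apply[OF assms one_closed] assms(2) by auto

lemma matched_pair_rb:
  assumes \<rho>: "is_rb_rho G B \<rho>" and \<mu>: "is_rb_mu G B \<mu>"
  shows "matched_pair_groups (rb_plus G B) (rb_minus G B) \<rho> \<mu>"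
proof -
  interpret dual: rota_baxter_group_neg_one G T by (rule rota_baxter_tilde)
  have \<mu>': "is_rb_rho G T \<mu>" and \<rho>': "is_rb_mu G T \<rho>"
    using \<rho> \<mu> by (simp_all add: is_rb_rho_tilde is_rb_mu_tilde)
  have img: "dual.T ` carrier G = B ` carrier G"
    by (simp add: tilde_tilde cong: image_cong)
  interpret \<rho>: group_action "rb_plus G B" "carrier (rb_minus G B)" \<rho>
    by (rule group_action_rb_rho[OF \<rho>])
  interpret \<mu>: group_action "rb_minus G B" "carrier (rb_plus G B)" \<mu>
    using dual.group_action_rb_rho[OF \<mu>'] by (simp add: rb_plus_tilde rb_minus_tilde)
  have \<rho>_mem: "\<rho> g h \<in> T ` carrier G" if "g \<in> B ` carrier G" "h \<in> T ` carrier G" for g h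
    using \<rho>.element_image[of g h] that by (simp add: rb_plus_simps rb_minus_simps)
  have \<mu>_mem: "\<mu> h g \<in> B ` carrier G" if "g \<in> B ` carrier G" "h \<in> T ` carrier G" for g h
    using \<mu>.element_image[of h g] that by (simp add: rb_plus_simps rb_minus_simps)
  note inv_mem = subgroup.m_inv_closed[OF subgroup_range_B]
    subgroup.m_inv_closed[OF dual.subgroup_range_B]
  show ?thesis
  proof (intro matched_pair_groups.intro matched_pair_groups_axioms.intro
      group_rb_plus group_rb_minus \<rho>.group_action_axioms \<mu>.group_action_axioms;
      unfold rb_plus_simps(1-3) rb_minus_simps(1-3))
    fix g b1 b2
    assume "g \<in> B ` carrier G" "b1 \<in> T ` carrier G" "b2 \<in> T ` carrier G"
    then show "\<rho> (inv\<^bsub>rb_plus G B\<^esub> g) (b1 \<otimes> b2) = \<rho> (inv\<^bsub>rb_plus G B\<^esub> g) b1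
        \<otimes> \<rho> (inv\<^bsub>rb_plus G B\<^esub> (\<mu> (inv\<^bsub>rb_minus G B\<^esub> b1) g)) b2"
      using rb_rho_mult[OF \<rho> \<mu>] by (simp add: rb_plus_simps rb_minus_simps \<mu>_mem inv_mem)
  next
    fix a1 a2 h
    assume "a1 \<in> B ` carrier G" "a2 \<in> B ` carrier G" "h \<in> T ` carrier G"
    then show "\<mu> (inv\<^bsub>rb_minus G B\<^esub> h) (a1 \<otimes> a2) = \<mu> (inv\<^bsub>rb_minus G B\<^esub> h) a1
        \<otimes> \<mu> (inv\<^bsub>rb_minus G B\<^esub> (\<rho> (inv\<^bsub>rb_plus G B\<^esub> a1) h)) a2"
      using dual.rb_rho_mult[OF \<mu>' \<rho>', unfolded img]
      by (simp add: rb_plus_simps rb_minus_simps \<rho>_mem inv_mem)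
  qed (simp_all add: rb_rho_one[OF \<rho>] dual.rb_rho_one[OF \<mu>'])
qed

end

theorem theorem4p6:
  fixes G :: "('a, 'm) monoid_scheme" and B :: "'a \<Rightarrow> 'a"
  assumes "rota_baxter_group_neg_one G B"
  shows "(\<exists>!\<rho>. is_rb_rho G B \<rho>) \<and> (\<exists>!\<mu>. is_rb_mu G B \<mu>) \<and>
    (\<forall>\<rho> \<mu>. is_rb_rho G B \<rho> \<longrightarrow> is_rb_mu G B \<mu> \<longrightarrow>
      matched_pair_groups (rb_plus G B) (rb_minus G B) \<rho> \<mu>)"
  using rota_baxter_group_neg_one.ex1_rb_rho[OF assms]
    rota_baxter_group_neg_one.ex1_rb_mu[OF assms]
    rota_baxter_group_neg_one.matched_pair_rb[OF assms]
  by blast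

end
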